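(* (a) Let $\mathcal P(\boldsymbol\alpha,\boldsymbol\ell)$ be a non-exceptional curvilinear polygon with $n$ vertices, and let $\sigma>0$ be a root of $F^{\mathcal P}(\boldsymbol\alpha,\boldsymbol\ell,\cdot)$. Then $\sigma$ is a quasi-eigenvalue of multiplicity two if additionally $F_{\rm odd}(\boldsymbol\alpha,\boldsymbol\ell,\sigma)=0$, and of multiplicity one otherwise. (b) Let $\mathcal P(\boldsymbol\alpha,\boldsymbol\ell)$ have exceptional angles, with exceptional boundary components $\mathcal Y_1,\dots,\mathcal Y_K$ as described in the context, $\mathcal Y_\kappa$ having angle vector $\boldsymbol\alpha^{(\kappa)}$ and length vector $\boldsymbol\ell^{(\kappa)}$. Then $\sigma\ge0$ is a quasi-eigenvalue if and only if for some $\kappa\in\{1,\dots,K\}$ it is a root of $F_{\rm even}(\boldsymbol\alpha^{(\kappa)},\boldsymbol\ell^{(\kappa)},\cdot)$ in the case $\mathcal O(\alpha_{E_{\kappa-1}})=\mathcal O(\alpha_{E_\kappa})$, respectively of $F_{\rm odd}(\boldsymbol\alpha^{(\kappa)},\boldsymbol\ell^{(\kappa)},\cdot)$ in the case $\mathcal O(\alpha_{E_{\kappa-1}})=-\mathcal O(\alpha_{E_\kappa})$. The multiplicity of a quasi-eigenvalue $\sigma>0$ equals the number of $\kappa$ for which $\sigma$ is a root of the corresponding polynomial, and the multiplicity of $\sigma=0$ is half the number of $\kappa$ for which $F_{\rm odd}$ is the corresponding polynomial.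
   Context: For $\boldsymbol\zeta\in\{\pm1\}^n$ (cyclic $\zeta_{n+1}=\zeta_1$), $\mathrm{ch}(\boldsymbol\zeta)=\{j:\zeta_j\ne\zeta_{j+1}\}$, $\mathfrak p_{\boldsymbol\zeta}(\boldsymbol\alpha)=\prod_{j\in\mathrm{ch}(\boldsymbol\zeta)}\cos(\pi^2/(2\alpha_j))$ (empty product $1$). For $\boldsymbol\alpha\in(0,\pi)^n$, $\boldsymbol\ell\in(0,\infty)^n$: $F_{\rm even}(\boldsymbol\alpha,\boldsymbol\ell,\sigma)=\sum_{\boldsymbol\zeta\in\{\pm1\}^n,\zeta_1=1}\mathfrak p_{\boldsymbol\zeta}(\boldsymbol\alpha)\cos(\boldsymbol\ell\cdot\boldsymbol\zeta\sigma)$, $F_{\rm odd}(\boldsymbol\alpha,\boldsymbol\ell,\sigma)=\sum_{\boldsymbol\zeta\in\{\pm1\}^n,\zeta_1=1}\mathfrak p_{\boldsymbol\zeta}(\boldsymbol\alpha)\sin(\boldsymbol\ell\cdot\boldsymbol\zeta\sigma)$, $F^{\mathcal P}=F_{\rm even}-\prod_{j=1}^n\sin(\pi^2/(2\alpha_j))$. A curvilinear polygon $\mathcal P(\boldsymbol\alpha,\boldsymbol\ell)$: bounded simply connected planar domain bounded by $n$ smooth arcs $I_j$ of lengths $\ell_j$, vertices $V_1,\dots,V_n$ clockwise (cyclic indices), $I_j$ from $V_{j-1}$ to $V_j$, interior angle $\alpha_j\in(0,\pi)$ at $V_j$. $\mathcal E=\{\pi/(2k)\}$, $\mathcal O(\pi/(2k))=(-1)^k$;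 non-exceptional means no $\alpha_j\in\mathcal E$. $\mathtt A(\alpha)=\begin{pmatrix}\csc\frac{\pi^2}{2\alpha}&-i\cot\frac{\pi^2}{2\alpha}\\ i\cot\frac{\pi^2}{2\alpha}&\csc\frac{\pi^2}{2\alpha}\end{pmatrix}$ ($\alpha\notin\mathcal E$), $\mathtt B(\ell,\sigma)=\operatorname{diag}(e^{i\ell\sigma},e^{-i\ell\sigma})$. Non-exceptional quasi-eigenvalues: $\sigma\ge0$ with $1$ an eigenvalue of $\mathtt T(\sigma)=\mathtt A(\alpha_n)\mathtt B(\ell_n,\sigma)\cdots\mathtt A(\alpha_1)\mathtt B(\ell_1,\sigma)$, multiplicity of $\sigma>0$ = geometric multiplicity of eigenvalue $1$. Exceptional case: exceptional vertices $V_{E_1},\dots,V_{E_K}$, $1\le E_1<\dots<E_K=n$, $E_0:=E_K$; the exceptional component $\mathcal Y_\kappa$ consists of the arcs $I_{E_{\kappa-1}+1},\dots,I_{E_\kappa}$ (mod $n$), with $\boldsymbol\ell^{(\kappa)}=(\ell_{E_{\kappa-1}+1},\dots,\ell_{E_\kappa})$ and $\boldsymbol\alpha^{(\kappa)}=(\alpha_{E_{\kappa-1}+1},\dots,\alpha_{E_\kappa})$ (last entry the exceptional angle). $\mathtt U_\kappa(\sigma)=\mathtt B(\ell_{E_\kappa},\sigma)\mathtt A(\alpha_{E_\kappa-1})\cdots\mathtt A(\alpha_{E_{\kappa-1}+1})\mathtt B(\ell_{E_{\kappa-1}+1},\sigma)$; $\mathbf X_{\rm even}=\frac1{\sqrt2}(e^{-i\pi/4},e^{i\pi/4})^T$,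 $\mathbf X_{\rm odd}=\frac1{\sqrt2}(e^{i\pi/4},e^{-i\pi/4})^T$, $\mathbf X(\alpha)=\mathbf X_{\rm even}$ if $\mathcal O(\alpha)=1$ else $\mathbf X_{\rm odd}$; $u\cdot v=u_1\bar v_1+u_2\bar v_2$. $\sigma\ge0$ is a quasi-eigenvalue iff $\mathtt U_\kappa(\sigma)\mathbf X(\alpha_{E_{\kappa-1}})\cdot\mathbf X(\alpha_{E_\kappa})=0$ for some $\kappa$; multiplicity of $\sigma>0$ = number of such $\kappa$; multiplicity of $0$ = half the number of $\kappa$ with $\mathcal O(\alpha_{E_{\kappa-1}})\ne\mathcal O(\alpha_{E_\kappa})$. *)

theory Defs
  imports "HOL-Analysis.Analysis" "HOL-Library.FuncSet"
    "Jordan_Normal_Form.Jordan_Normal_Form_Uniqueness"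
begin

text \<open>Polygon data: angles alpha and lengths ell are functions on indices 1..n
  (as in the paper, 1-based).  Sign vectors zeta are functions in {1..n} ->E {-1,1}.\<close>

definition cyc_next :: "nat \<Rightarrow> nat \<Rightarrow> nat" where
  "cyc_next n j = (if j = n then 1 else j + 1)"

definition sign_vecs :: "nat \<Rightarrow> (nat \<Rightarrow> int) set" where
  "sign_vecs n = {z \<in> {1..n} \<rightarrow>\<^sub>E {-1, 1}. z 1 = 1}"

definition ch :: "nat \<Rightarrow> (nat \<Rightarrow> int) \<Rightarrow> nat set" where
  "ch n z = {j \<in> {1..n}. z j \<noteq> z (cyc_next n j)}"

definition pz :: "nat \<Rightarrow> (nat \<Rightarrow> int) \<Rightarrow> (nat \<Rightarrow> real) \<Rightarrow> real" where
  "pz n z \<alpha> = (\<Prod>j\<in>ch n z. cos (pi\<^sup>2 / (2 * \<alpha> j)))"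

definition ldot :: "nat \<Rightarrow> (nat \<Rightarrow> real) \<Rightarrow> (nat \<Rightarrow> int) \<Rightarrow> real" where
  "ldot n l z = (\<Sum>j=1..n. l j * of_int (z j))"

definition F_even :: "nat \<Rightarrow> (nat \<Rightarrow> real) \<Rightarrow> (nat \<Rightarrow> real) \<Rightarrow> real \<Rightarrow> real" where
  "F_even n \<alpha> l \<sigma> = (\<Sum>z\<in>sign_vecs n. pz n z \<alpha> * cos (ldot n l z * \<sigma>))"

definition F_odd :: "nat \<Rightarrow> (nat \<Rightarrow> real) \<Rightarrow> (nat \<Rightarrow> real) \<Rightarrow> real \<Rightarrow> real" where
  "F_odd n \<alpha> l \<sigma> = (\<Sum>z\<in>sign_vecs n. pz n z \<alpha> * sin (ldot n l z * \<sigma>))"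

definition F_P :: "nat \<Rightarrow> (nat \<Rightarrow> real) \<Rightarrow> (nat \<Rightarrow> real) \<Rightarrow> real \<Rightarrow> real" where
  "F_P n \<alpha> l \<sigma> = F_even n \<alpha> l \<sigma> - (\<Prod>j=1..n. sin (pi\<^sup>2 / (2 * \<alpha> j)))"

definition exc_angles :: "real set" where
  "exc_angles = {pi / (2 * real k) | k. k \<ge> (1::nat)}"

definition parity_O :: "real \<Rightarrow> int" where
  "parity_O a = (-1) ^ (THE k::nat. k \<ge> 1 \<and> a = pi / (2 * real k))"

definition admissible :: "nat \<Rightarrow> (nat \<Rightarrow> real) \<Rightarrow> (nat \<Rightarrow> real) \<Rightarrow> bool" where
  "admissible n \<alpha> l \<longleftrightarrow> n \<ge> 1 \<and> (\<forall>j\<in>{1..n}. 0 < \<alpha> j \<and> \<alpha> j < pi \<and> 0 < l j)"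

definition non_exceptional :: "nat \<Rightarrow> (nat \<Rightarrow> real) \<Rightarrow> bool" where
  "non_exceptional n \<alpha> \<longleftrightarrow> (\<forall>j\<in>{1..n}. \<alpha> j \<notin> exc_angles)"

definition matA :: "real \<Rightarrow> complex mat" where
  "matA a = (let c = complex_of_real (1 / sin (pi\<^sup>2 / (2 * a)));
                 t = complex_of_real (cot (pi\<^sup>2 / (2 * a)))
             in mat_of_rows_list 2 [[c, - \<i> * t], [\<i> * t, c]])"

definition matB :: "real \<Rightarrow> real \<Rightarrow> complex mat" where
  "matB l \<sigma> = mat_of_rows_list 2 [[cis (l * \<sigma>), 0], [0, cis (- (l * \<sigma>))]]"

fun segP :: "(nat \<Rightarrow> real) \<Rightarrow> (nat \<Rightarrow> real) \<Rightarrow> real \<Rightarrow> nat \<Rightarrow> nat \<Rightarrow> complex mat" where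
  "segP \<alpha> l \<sigma> s 0 = 1\<^sub>m 2"
| "segP \<alpha> l \<sigma> s (Suc m) = matA (\<alpha> (s + Suc m)) * matB (l (s + Suc m)) \<sigma> * segP \<alpha> l \<sigma> s m"

definition matT :: "nat \<Rightarrow> (nat \<Rightarrow> real) \<Rightarrow> (nat \<Rightarrow> real) \<Rightarrow> real \<Rightarrow> complex mat" where
  "matT n \<alpha> l \<sigma> = segP \<alpha> l \<sigma> 0 n"

definition qe_nonexc :: "nat \<Rightarrow> (nat \<Rightarrow> real) \<Rightarrow> (nat \<Rightarrow> real) \<Rightarrow> real \<Rightarrow> bool" where
  "qe_nonexc n \<alpha> l \<sigma> \<longleftrightarrow> \<sigma> \<ge> 0 \<and> eigenvalue (matT n \<alpha> l \<sigma>) 1"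

definition mult_nonexc :: "nat \<Rightarrow> (nat \<Rightarrow> real) \<Rightarrow> (nat \<Rightarrow> real) \<Rightarrow> real \<Rightarrow> nat" where
  "mult_nonexc n \<alpha> l \<sigma> = dim_gen_eigenspace (matT n \<alpha> l \<sigma>) 1 1"

text \<open>Exceptional case: E_1 < ... < E_K are the exceptional indices (E_K = n),
  E_0 := E_K = n, so the component kappa consists of arcs start+1 .. E_kappa
  with start = 0 for kappa = 1 and start = E_(kappa-1) otherwise.\<close>

definition exc_idx :: "nat \<Rightarrow> (nat \<Rightarrow> real) \<Rightarrow> nat set" where
  "exc_idx n \<alpha> = {j \<in> {1..n}. \<alpha> j \<in> exc_angles}"

definition numK :: "nat \<Rightarrow> (nat \<Rightarrow> real) \<Rightarrow> nat" where
  "numK n \<alpha> = card (exc_idx n \<alpha>)"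

definition E :: "nat \<Rightarrow> (nat \<Rightarrow> real) \<Rightarrow> nat \<Rightarrow> nat" where
  "E n \<alpha> \<kappa> = (if \<kappa> = 0 then sorted_list_of_set (exc_idx n \<alpha>) ! (numK n \<alpha> - 1)
                else sorted_list_of_set (exc_idx n \<alpha>) ! (\<kappa> - 1))"

definition comp_start :: "nat \<Rightarrow> (nat \<Rightarrow> real) \<Rightarrow> nat \<Rightarrow> nat" where
  "comp_start n \<alpha> \<kappa> = (if \<kappa> = 1 then 0 else E n \<alpha> (\<kappa> - 1))"

definition comp_len :: "nat \<Rightarrow> (nat \<Rightarrow> real) \<Rightarrow> nat \<Rightarrow> nat" where
  "comp_len n \<alpha> \<kappa> = E n \<alpha> \<kappa> - comp_start n \<alpha> \<kappa>"

definition comp_alpha :: "nat \<Rightarrow> (nat \<Rightarrow> real) \<Rightarrow> nat \<Rightarrow> nat \<Rightarrow> real" where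
  "comp_alpha n \<alpha> \<kappa> i = \<alpha> (comp_start n \<alpha> \<kappa> + i)"

definition comp_ell :: "nat \<Rightarrow> (nat \<Rightarrow> real) \<Rightarrow> (nat \<Rightarrow> real) \<Rightarrow> nat \<Rightarrow> nat \<Rightarrow> real" where
  "comp_ell n \<alpha> l \<kappa> i = l (comp_start n \<alpha> \<kappa> + i)"

definition matU :: "nat \<Rightarrow> (nat \<Rightarrow> real) \<Rightarrow> (nat \<Rightarrow> real) \<Rightarrow> nat \<Rightarrow> real \<Rightarrow> complex mat" where
  "matU n \<alpha> l \<kappa> \<sigma> = matB (l (E n \<alpha> \<kappa>)) \<sigma> *
       segP \<alpha> l \<sigma> (comp_start n \<alpha> \<kappa>) (comp_len n \<alpha> \<kappa> - 1)"

definition X_even :: "complex vec" where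
  "X_even = vec_of_list [cis (- pi / 4) / sqrt 2, cis (pi / 4) / sqrt 2]"

definition X_odd :: "complex vec" where
  "X_odd = vec_of_list [cis (pi / 4) / sqrt 2, cis (- pi / 4) / sqrt 2]"

definition Xvec :: "real \<Rightarrow> complex vec" where
  "Xvec a = (if parity_O a = 1 then X_even else X_odd)"

definition hdot :: "complex vec \<Rightarrow> complex vec \<Rightarrow> complex" where
  "hdot u v = u $ 0 * cnj (v $ 0) + u $ 1 * cnj (v $ 1)"

definition exc_cond :: "nat \<Rightarrow> (nat \<Rightarrow> real) \<Rightarrow> (nat \<Rightarrow> real) \<Rightarrow> nat \<Rightarrow> real \<Rightarrow> bool" where
  "exc_cond n \<alpha> l \<kappa> \<sigma> \<longleftrightarrow>
     hdot (matU n \<alpha> l \<kappa> \<sigma> *\<^sub>v Xvec (\<alpha> (E n \<alpha> (\<kappa> - 1)))) (Xvec (\<alpha> (E n \<alpha> \<kappa>))) = 0"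

definition qe_exc :: "nat \<Rightarrow> (nat \<Rightarrow> real) \<Rightarrow> (nat \<Rightarrow> real) \<Rightarrow> real \<Rightarrow> bool" where
  "qe_exc n \<alpha> l \<sigma> \<longleftrightarrow> \<sigma> \<ge> 0 \<and> (\<exists>\<kappa>\<in>{1..numK n \<alpha>}. exc_cond n \<alpha> l \<kappa> \<sigma>)"

definition mult_exc :: "nat \<Rightarrow> (nat \<Rightarrow> real) \<Rightarrow> (nat \<Rightarrow> real) \<Rightarrow> real \<Rightarrow> real" where
  "mult_exc n \<alpha> l \<sigma> =
     (if \<sigma> > 0 then real (card {\<kappa>\<in>{1..numK n \<alpha>}. exc_cond n \<alpha> l \<kappa> \<sigma>})
      else real (card {\<kappa>\<in>{1..numK n \<alpha>}.
              parity_O (\<alpha> (E n \<alpha> (\<kappa> - 1))) \<noteq> parity_O (\<alpha> (E n \<alpha> \<kappa>))}) / 2)"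

definition comp_root :: "nat \<Rightarrow> (nat \<Rightarrow> real) \<Rightarrow> (nat \<Rightarrow> real) \<Rightarrow> nat \<Rightarrow> real \<Rightarrow> bool" where
  "comp_root n \<alpha> l \<kappa> \<sigma> \<longleftrightarrow>
     (if parity_O (\<alpha> (E n \<alpha> (\<kappa> - 1))) = parity_O (\<alpha> (E n \<alpha> \<kappa>))
      then F_even (comp_len n \<alpha> \<kappa>) (comp_alpha n \<alpha> \<kappa>) (comp_ell n \<alpha> l \<kappa>) \<sigma> = 0
      else F_odd (comp_len n \<alpha> \<kappa>) (comp_alpha n \<alpha> \<kappa>) (comp_ell n \<alpha> l \<kappa>) \<sigma> = 0)"

end

theory Submission
  imports Defs
begin

text \<open>Expand the product of the matrices A and B over sign paths: a sign vector records the row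
  index chosen at each arc, and up to the factors \<open>1 / sin\<close> a change of sign at vertex j contributes
  \<open>\<plusminus>\<i> cos (\<pi>\<^sup>2 / (2 \<alpha>\<^sub>j))\<close>.  In a closed path the factors \<open>\<i>\<close> and \<open>-\<i>\<close> cancel in pairs, so the upper
  left entry of T is \<open>(F_even + \<i> F_odd) / \<Prod> sin\<close>.  Since T has determinant 1 and the form
  \<open>(a, b; cnj b, cnj a)\<close>, the number 1 is an eigenvalue iff \<open>Re a = 1\<close>; then \<open>\<bar>b\<bar> = \<bar>Im a\<bar>\<close>, so T is the
  identity iff \<open>Im a = 0\<close>.  In the exceptional case the phases of the vectors X absorb the factor
  \<open>\<plusminus>\<i>\<close> of a non-closed path, while \<open>cos (\<pi>\<^sup>2 / (2 \<alpha>))\<close> equals the parity of the exceptional angle \<open>\<alpha>\<close>.\<close>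

section \<open>Dimension of the kernel of a matrix\<close>

text \<open>Span and linear independence inside the kernel agree with those of the ambient space, so
  a basis of the kernel can be handled with the dimension lemmas of
  \<open>vec_space\<close>.\<close>

lemma kernel_dim_basis:
  fixes A :: "'a :: field mat"
  assumes A: "A \<in> carrier_mat m n"
  obtains B where "finite B" "B \<subseteq> carrier_vec n" "card B = kernel_dim A"
    "module.lin_indpt class_ring (module_vec TYPE('a) n) B"
    "LinearCombinations.module.span class_ring (module_vec TYPE('a) n) B = mat_kernel A"
proof -
  interpret K: kernel m n A by (unfold_locales, rule A)
  from kernel_basis_exists[OF A] obtain B where B: "finite B" "K.Ker.basis B" by auto
  have sub: "B \<subseteq> mat_kernel A" using B(2) unfolding K.Ker.basis_def by auto
  have "K.NC.span B = mat_kernel A"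
    using B(2) K.span_same[OF sub] unfolding K.Ker.basis_def by auto
  moreover have "K.NC.lin_indpt B"
    using B(2) K.lindep_same[OF sub] unfolding K.Ker.basis_def by auto
  moreover have "card B = kernel_dim A"
    using K.Ker.dim_basis[OF B] A by (simp add: kernel_dim_def)
  ultimately show thesis
    using that B(1) sub mat_kernel_carrier[OF A] by auto
qed

lemma kernel_dim_le:
  fixes A :: "'a :: field mat"
  assumes A: "A \<in> carrier_mat m n"
  shows "kernel_dim A \<le> n"
proof -
  interpret V: vec_space "TYPE('a)" n .
  obtain B where "finite B" "B \<subseteq> carrier_vec n" "card B = kernel_dim A" "V.lin_indpt B"
    using kernel_dim_basis[OF A] by metis
  then show ?thesis
    using V.li_le_dim(2)[of B] V.fin_dim V.dim_is_n by auto
qed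

text \<open>If \<open>n\<close> independent vectors lie in the kernel, they span everything, so
  every unit vector is annihilated and every column vanishes.\<close>

lemma kernel_dim_full_iff:
  fixes A :: "'a :: field mat"
  assumes A: "A \<in> carrier_mat m n"
  shows "kernel_dim A = n \<longleftrightarrow> A = 0\<^sub>m m n"
proof -
  interpret V: vec_space "TYPE('a)" n .
  obtain B where B: "finite B" "B \<subseteq> carrier_vec n" "card B = kernel_dim A" "V.lin_indpt B"
    and span: "V.span B = mat_kernel A"
    using kernel_dim_basis[OF A] by metis
  show ?thesis
  proof
    assume "kernel_dim A = n"
    then have "V.basis B"
      using B V.dim_is_n V.fin_dim V.dim_li_is_basis[of B] by auto
    then have ker: "mat_kernel A = carrier_vec n"
      using span unfolding V.basis_def by auto
    show "A = 0\<^sub>m m n"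
    proof (rule eq_matI)
      fix i j assume ij: "i < dim_row (0\<^sub>m m n :: 'a mat)" "j < dim_col (0\<^sub>m m n :: 'a mat)"
      have "unit_vec n j \<in> mat_kernel A" using ker by auto
      from mat_kernelD(2)[OF A this] have "(A *\<^sub>v unit_vec n j) $ i = 0" using ij by auto
      then show "A $$ (i, j) = 0\<^sub>m m n $$ (i, j)"
        using ij A by (simp add: scalar_prod_right_unit[of j n])
    qed (use A in auto)
  next
    assume "A = 0\<^sub>m m n"
    then have "mat_kernel A = carrier_vec n" unfolding mat_kernel[OF A] by auto
    then have "V.basis B" unfolding V.basis_def using B span by auto
    then show "kernel_dim A = n" using V.dim_basis[of B] B V.dim_is_n by auto
  qed
qed

lemma kernel_dim_pos:
  fixes A :: "'a :: field mat"
  assumes A: "A \<in> carrier_mat m n" and v: "v \<in> carrier_vec n" "v \<noteq> 0\<^sub>v n" "A *\<^sub>v v = 0\<^sub>v m"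
  shows "0 < kernel_dim A"
proof (rule ccontr)
  assume "\<not> 0 < kernel_dim A"
  interpret V: vec_space "TYPE('a)" n .
  obtain B where "finite B" "card B = kernel_dim A" "V.span B = mat_kernel A"
    using kernel_dim_basis[OF A] by metis
  with \<open>\<not> 0 < kernel_dim A\<close> have "V.span {} = mat_kernel A" by auto
  moreover have "v \<in> mat_kernel A" using mat_kernelI[OF A] v by auto
  ultimately show False using v(2) V.span_empty by auto
qed

section \<open>Two-by-two matrices: products, eigenvalues, geometric multiplicity\<close>

text \<open>Since this is only an abbreviation, \<open>matA\<close> and \<open>matB\<close> unfold
  directly into it, and matrix identities become scalar ones.\<close>

abbreviation mat22 :: "'a \<Rightarrow> 'a \<Rightarrow> 'a \<Rightarrow> 'a \<Rightarrow> 'a mat" where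
  "mat22 a b c d \<equiv> mat_of_rows_list 2 [[a, b], [c, d]]"

lemma mat22_carrier [simp]: "mat22 a b c d \<in> carrier_mat 2 2"
  by (simp add: mat_of_rows_list_def numeral_2_eq_2)

lemma mat22_mult:
  "mat22 a b c d * mat22 a' b' c' d' =
    mat22 (a * a' + b * c') (a * b' + b * d') (c * a' + d * c') (c * b' + d * d')"
  for a b c d :: "'a :: comm_ring_1"
  by (rule eq_matI)
    (auto simp: mat_of_rows_list_def scalar_prod_def numeral_2_eq_2 less_Suc_eq algebra_simps)

lemma mat22_eq_iff:
  "mat22 a b c d = mat22 a' b' c' d' \<longleftrightarrow> a = a' \<and> b = b' \<and> c = c' \<and> d = d'"
proof
  assume "mat22 a b c d = mat22 a' b' c' d'"
  then have "mat22 a b c d $$ (i, j) = mat22 a' b' c' d' $$ (i, j)" for i j by simp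
  from this[of 0 0] this[of 0 1] this[of 1 0] this[of 1 1]
  show "a = a' \<and> b = b' \<and> c = c' \<and> d = d'"
    by (simp add: mat_of_rows_list_def)
qed simp

lemma zero_mat22: "0\<^sub>m 2 2 = mat22 0 0 0 (0 :: 'a :: zero)"
  by (rule eq_matI) (auto simp: mat_of_rows_list_def numeral_2_eq_2 less_Suc_eq)

lemma one_mat22: "1\<^sub>m 2 = mat22 1 0 0 (1 :: 'a :: {zero, one})"
  by (rule eq_matI) (auto simp: mat_of_rows_list_def numeral_2_eq_2 less_Suc_eq)

lemma char_matrix_mat22: "char_matrix (mat22 a b c d) e = mat22 (a - e) b c (d - e)"
  by (rule eq_matI)
    (auto simp: char_matrix_def mat_of_rows_list_def numeral_2_eq_2 less_Suc_eq)

lemma det_mat22: "det (mat22 a b c d) = a * d - b * c"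
  for a b c d :: "'a :: comm_ring_1"
proof -
  have "mat_delete (mat22 a b c d) 0 0 \<in> carrier_mat 1 1" "mat_delete (mat22 a b c d) 0 1 \<in> carrier_mat 1 1"
    using mat_delete_carrier[OF mat22_carrier] by auto
  note dets = this[THEN det_single]
  show ?thesis
    unfolding laplace_expansion_row[OF mat22_carrier, of 0 a b c d, simplified]
    using dets by (simp add: numeral_2_eq_2 cofactor_def mat_delete_def mat_of_rows_list_def)
qed

lemma eigenvalue_mat22:
  "eigenvalue (mat22 a b c d) e \<longleftrightarrow> (a - e) * (d - e) = b * c"
  for a b c d :: "'a :: field"
  by (simp add: eigenvalue_det[OF mat22_carrier] char_matrix_mat22 det_mat22)

text \<open>With exponent 1 the generalised eigenspace is the kernel of the characteristic matrix.
  An eigenvalue forces dimension at least 1; dimension 2 forces that matrix to vanish.\<close>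

lemma dim_eigenspace_mat22:
  fixes a b c d :: "'a :: field"
  assumes "eigenvalue (mat22 a b c d) e"
  shows "dim_gen_eigenspace (mat22 a b c d) e 1 =
    (if a = e \<and> b = 0 \<and> c = 0 \<and> d = e then 2 else 1)"
proof -
  define N where "N = char_matrix (mat22 a b c d) e"
  have N: "N \<in> carrier_mat 2 2" by (simp add: N_def)
  have "0 < kernel_dim N"
    using assms kernel_dim_pos[OF N] eigenvalue_char_matrix[OF mat22_carrier]
    unfolding N_def by metis
  moreover have "kernel_dim N = 2 \<longleftrightarrow> a = e \<and> b = 0 \<and> c = 0 \<and> d = e"
    unfolding kernel_dim_full_iff[OF N]
    by (simp add: N_def char_matrix_mat22 zero_mat22 mat22_eq_iff)
  moreover have "dim_gen_eigenspace (mat22 a b c d) e 1 = kernel_dim N"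
    using N by (simp add: dim_gen_eigenspace_def N_def)
  ultimately show ?thesis using kernel_dim_le[OF N] by auto
qed

section \<open>Path sums and their relation to \<open>F_even\<close> and
  \<open>F_odd\<close>\<close>

text \<open>Sums over non-closed sign paths from 1 to b: the factor for a possible sign change
  at the last vertex, between \<open>z m\<close> and \<open>z 1\<close>, is left out.\<close>

definition path_sum :: "(nat \<Rightarrow> real) \<Rightarrow> (nat \<Rightarrow> real) \<Rightarrow> real \<Rightarrow> nat \<Rightarrow> int \<Rightarrow> complex" where
  "path_sum c l \<sigma> m b =
    (\<Sum>z | z \<in> sign_vecs m \<and> z m = b.
      of_real (\<Prod>j\<in>{1..<m}. if z j = z (Suc j) then 1 else c j) * cis (ldot m l z * \<sigma>))"

lemma finite_sign_vecs [simp]: "finite (sign_vecs m)"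
  unfolding sign_vecs_def by (rule finite_subset[OF _ finite_PiE[of "{1..m}" "\<lambda>_. {-1, 1}"]]) auto

lemma sign_vecs_one: "sign_vecs 1 = {\<lambda>i\<in>{1}. 1}"
proof (rule Set.set_eqI)
  fix z
  show "z \<in> sign_vecs 1 \<longleftrightarrow> z \<in> {\<lambda>i\<in>{1}. 1}"
    by (auto simp: sign_vecs_def PiE_iff extensional_def fun_eq_iff)
qed

text \<open>Pulls out a factor that depends only on the last sign. It serves both to extend a path
  by one arc and to close it at the last vertex.\<close>

lemma sum_sign_vecs_last:
  fixes f :: "(nat \<Rightarrow> int) \<Rightarrow> complex"
  assumes "1 \<le> m"
  shows "(\<Sum>z\<in>sign_vecs m. g (z m) * f z) =
    g 1 * (\<Sum>z | z \<in> sign_vecs m \<and> z m = 1. f z) +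
    g (-1) * (\<Sum>z | z \<in> sign_vecs m \<and> z m = -1. f z)"
proof -
  have "sign_vecs m = {z \<in> sign_vecs m. z m = 1} \<union> {z \<in> sign_vecs m. z m = -1}"
    using assms by (auto simp: sign_vecs_def PiE_iff)
  then have "(\<Sum>z\<in>sign_vecs m. g (z m) * f z) =
      (\<Sum>z\<in>{z \<in> sign_vecs m. z m = 1} \<union> {z \<in> sign_vecs m. z m = -1}. g (z m) * f z)"
    by simp
  also have "\<dots> = (\<Sum>z | z \<in> sign_vecs m \<and> z m = 1. g (z m) * f z) +
      (\<Sum>z | z \<in> sign_vecs m \<and> z m = -1. g (z m) * f z)"
    by (rule sum.union_disjoint) auto
  also have "\<dots> = (\<Sum>z | z \<in> sign_vecs m \<and> z m = 1. g 1 * f z) +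
      (\<Sum>z | z \<in> sign_vecs m \<and> z m = -1. g (-1) * f z)"
    by (intro arg_cong2[where f = "(+)"] sum.cong) auto
  finally show ?thesis by (simp add: sum_distrib_left)
qed

lemma path_sum_one:
  "path_sum c l \<sigma> 1 1 = cis (l 1 * \<sigma>)" "path_sum c l \<sigma> 1 (-1) = 0"
proof -
  have "{z. z \<in> sign_vecs 1 \<and> z 1 = 1} = {\<lambda>i\<in>{1}. 1}"
    "{z. z \<in> sign_vecs 1 \<and> z 1 = -1} = {}"
    unfolding sign_vecs_one by auto
  then show "path_sum c l \<sigma> 1 1 = cis (l 1 * \<sigma>)" "path_sum c l \<sigma> 1 (-1) = 0"
    unfolding path_sum_def by (simp_all only:) (simp_all add: ldot_def)
qed

text \<open>Transfer recursion: the new arc contributes a phase, and vertex \<open>m\<close>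
  contributes 1 or \<open>c m\<close> according to whether the previous sign was \<open>b\<close> or
  \<open>- b\<close>.\<close>

lemma path_sum_Suc:
  assumes m: "1 \<le> m" and b: "b = 1 \<or> b = -1"
  shows "path_sum c l \<sigma> (Suc m) b = cis (l (Suc m) * of_int b * \<sigma>) *
    (path_sum c l \<sigma> m b + of_real (c m) * path_sum c l \<sigma> m (- b))"
proof -
  define w where "w m z = complex_of_real (\<Prod>j\<in>{1..<m}. if z j = z (Suc j) then 1 else c j) *
      cis (ldot m l z * \<sigma>)" for m and z :: "nat \<Rightarrow> int"
  \<comment> \<open>The weight of vertex \<open>m\<close> when the sign passes from \<open>a\<close>
    to \<open>b\<close>.\<close>
  define g where "g a = (if a = b then 1 else complex_of_real (c m))" for a
  define \<phi> where "\<phi> = cis (l (Suc m) * of_int b * \<sigma>)"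
  have w: "w (Suc m) (z(Suc m := b)) = \<phi> * (g (z m) * w m z)" for z
  proof -
    have "(\<Prod>j\<in>{1..<Suc m}. if (z(Suc m := b)) j = (z(Suc m := b)) (Suc j) then 1 else c j) =
        (\<Prod>j\<in>{1..<m}. if z j = z (Suc j) then 1 else c j) * (if z m = b then 1 else c m)"
      using m by (simp add: prod.atLeastLessThan_Suc)
    moreover have "ldot (Suc m) l (z(Suc m := b)) = ldot m l z + l (Suc m) * of_int b"
      using m by (simp add: ldot_def)
    ultimately show ?thesis
      by (simp add: w_def g_def \<phi>_def cis_mult[symmetric] distrib_right)
  qed
  have "(\<Sum>z | z \<in> sign_vecs (Suc m) \<and> z (Suc m) = b. w (Suc m) z) =
      (\<Sum>z\<in>sign_vecs m. \<phi> * (g (z m) * w m z))"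
  \<comment> \<open>Sign vectors are extensional, so appending \<open>b\<close> and restricting to
    the first \<open>m\<close> arcs are mutually inverse.\<close>
  proof (rule sum.reindex_bij_witness[where i = "\<lambda>z. z(Suc m := b)" and j = "\<lambda>z. restrict z {1..m}"])
    fix z assume "z \<in> sign_vecs m"
    then show "z(Suc m := b) \<in> {z. z \<in> sign_vecs (Suc m) \<and> z (Suc m) = b}"
      "restrict (z(Suc m := b)) {1..m} = z"
      using m b by (auto simp: sign_vecs_def PiE_iff extensional_def fun_eq_iff)
  next
    fix z assume z: "z \<in> {z. z \<in> sign_vecs (Suc m) \<and> z (Suc m) = b}"
    then show "restrict z {1..m} \<in> sign_vecs m"
      using m by (auto simp: sign_vecs_def PiE_iff)
    show eq: "(restrict z {1..m})(Suc m := b) = z"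
      using z by (auto simp: sign_vecs_def PiE_iff extensional_def fun_eq_iff)
    show "\<phi> * (g (restrict z {1..m} m) * w m (restrict z {1..m})) = w (Suc m) z"
      using w[of "restrict z {1..m}"] unfolding eq by simp
  qed
  also have "\<dots> = \<phi> * (g 1 * (\<Sum>z | z \<in> sign_vecs m \<and> z m = 1. w m z) +
      g (-1) * (\<Sum>z | z \<in> sign_vecs m \<and> z m = -1. w m z))"
    using sum_sign_vecs_last[OF m, of g "w m"] unfolding sum_distrib_left[symmetric] by simp
  finally show ?thesis
    unfolding path_sum_def w_def[symmetric] using b by (auto simp: g_def \<phi>_def)
qed

text \<open>Closing the path: since \<open>z 1 = 1\<close>, vertex \<open>n\<close> is a sign change
  exactly when \<open>z n = -1\<close>, and then supplies the factor \<open>c n\<close> missing from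
  the path sum.\<close>

lemma F_even_F_odd_path_sum:
  fixes \<alpha> l :: "nat \<Rightarrow> real"
  assumes n: "1 \<le> n"
  defines "c \<equiv> \<lambda>j. cos (pi\<^sup>2 / (2 * \<alpha> j))"
  shows "Complex (F_even n \<alpha> l \<sigma>) (F_odd n \<alpha> l \<sigma>) =
    path_sum c l \<sigma> n 1 + of_real (c n) * path_sum c l \<sigma> n (-1)"
proof -
  define P where "P z = (\<Prod>j\<in>{1..<n}. if z j = z (Suc j) then 1 else c j)" for z :: "nat \<Rightarrow> int"
  have pz: "pz n z \<alpha> = (if z n = 1 then 1 else c n) * P z" if "z \<in> sign_vecs n" for z
  proof -
    have "pz n z \<alpha> = (\<Prod>j\<in>{1..n}. if z j = z (cyc_next n j) then 1 else c j)"
      unfolding pz_def ch_def prod.inter_filter[OF finite_atLeastAtMost] c_def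
      by (intro prod.cong) auto
    also have "{1..n} = insert n {1..<n}" using n by auto
    also have "(\<Prod>j\<in>insert n {1..<n}. if z j = z (cyc_next n j) then 1 else c j) =
        (if z n = 1 then 1 else c n) * (\<Prod>j\<in>{1..<n}. if z j = z (cyc_next n j) then 1 else c j)"
      using that by (simp add: cyc_next_def sign_vecs_def)
    also have "(\<Prod>j\<in>{1..<n}. if z j = z (cyc_next n j) then 1 else c j) = P z"
      unfolding P_def by (intro prod.cong) (auto simp: cyc_next_def)
    finally show ?thesis .
  qed
  have "Complex (F_even n \<alpha> l \<sigma>) (F_odd n \<alpha> l \<sigma>) =
      (\<Sum>z\<in>sign_vecs n. of_real (pz n z \<alpha>) * cis (ldot n l z * \<sigma>))"
    by (simp add: complex_eq_iff F_even_def F_odd_def)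
  also have "\<dots> = (\<Sum>z\<in>sign_vecs n. (if z n = 1 then 1 else of_real (c n)) *
      (of_real (P z) * cis (ldot n l z * \<sigma>)))"
    by (intro sum.cong) (auto simp: pz)
  also have "\<dots> = path_sum c l \<sigma> n 1 + of_real (c n) * path_sum c l \<sigma> n (-1)"
    using sum_sign_vecs_last[OF n, of "\<lambda>a. if a = 1 then 1 else of_real (c n)"
        "\<lambda>z. of_real (P z) * cis (ldot n l z * \<sigma>)"]
    by (simp add: path_sum_def P_def)
  finally show ?thesis .
qed

text \<open>For real \<open>t\<close> the cross terms cancel, so the indefinite form is only
  rescaled. For \<open>t\<close> a cosine the scale is the squared sine.\<close>

lemma hyperbolic_rotation_cmod:
  "(cmod (p + of_real t * q))\<^sup>2 - (cmod (q + of_real t * p))\<^sup>2 =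
    (1 - t\<^sup>2) * ((cmod p)\<^sup>2 - (cmod q)\<^sup>2)"
  unfolding cmod_power2 by (simp add: power2_eq_square algebra_simps)

text \<open>Up to unimodular phases the recursion is the map of
  \<open>hyperbolic_rotation_cmod\<close>, so each vertex multiplies the form by a squared sine,
  starting from 1. This is the determinant identity for the matrices below with denominators
  cleared.\<close>

lemma path_sum_norm:
  fixes c s :: "nat \<Rightarrow> real"
  assumes "\<And>j. (s j)\<^sup>2 + (c j)\<^sup>2 = 1"
  shows "(cmod (path_sum c l \<sigma> (Suc m) 1))\<^sup>2 - (cmod (path_sum c l \<sigma> (Suc m) (-1)))\<^sup>2 =
    (\<Prod>j=1..m. s j)\<^sup>2"
proof (induction m)
  case 0
  then show ?case using path_sum_one[of c l \<sigma>] by simp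
next
  case (Suc m)
  have "(s (Suc m))\<^sup>2 = 1 - (c (Suc m))\<^sup>2" using assms[of "Suc m"] by simp
  then show ?case
    using Suc.IH by (simp add: path_sum_Suc norm_mult hyperbolic_rotation_cmod power_mult_distrib)
qed

section \<open>Entries of the transfer matrices\<close>

text \<open>Moves an exceptional component to a chain starting at index 0, in line with
  \<open>comp_alpha\<close> and \<open>comp_ell\<close>.\<close>

lemma segP_shift: "segP \<alpha> l \<sigma> k m = segP (\<lambda>i. \<alpha> (k + i)) (\<lambda>i. l (k + i)) \<sigma> 0 m"
  by (induction m) auto

lemma segP_carrier [simp]: "segP \<alpha> l \<sigma> k m \<in> carrier_mat 2 2"
proof (induction m)
  case (Suc m)
  have "matA (\<alpha> (k + Suc m)) * matB (l (k + Suc m)) \<sigma> \<in> carrier_mat 2 2"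
    unfolding matA_def matB_def Let_def by (rule mult_carrier_mat; rule mat22_carrier)
  with Suc show ?case by (auto intro: mult_carrier_mat)
qed simp

lemma matA_carrier [simp]: "matA a \<in> carrier_mat 2 2"
  and matB_carrier [simp]: "matB a \<sigma> \<in> carrier_mat 2 2"
  by (simp_all add: matA_def matB_def Let_def)

text \<open>A path from sign 1 to -1 has one more downward than upward change, whence the single
  factor \<open>\<i>\<close> at \<open>q\<close>. The product stops before the A of the last vertex,
  so it serves for \<open>matU\<close>, where that vertex is exceptional, and for
  \<open>matT\<close> after one more multiplication.\<close>

lemma matB_segP:
  fixes \<alpha> l :: "nat \<Rightarrow> real" and \<sigma> :: real and c :: "nat \<Rightarrow> real"
  assumes "\<And>j. j \<in> {1..m} \<Longrightarrow> sin (pi\<^sup>2 / (2 * \<alpha> j)) \<noteq> 0"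
  defines "c \<equiv> \<lambda>j. cos (pi\<^sup>2 / (2 * \<alpha> j))"
    and "S \<equiv> \<lambda>m. complex_of_real (\<Prod>j=1..m. sin (pi\<^sup>2 / (2 * \<alpha> j)))"
    and "p \<equiv> \<lambda>m. path_sum c l \<sigma> (Suc m) 1"
    and "q \<equiv> \<lambda>m. path_sum c l \<sigma> (Suc m) (-1)"
  shows "matB (l (Suc m)) \<sigma> * segP \<alpha> l \<sigma> 0 m =
    mat22 (p m / S m) (- \<i> * cnj (q m) / S m) (\<i> * q m / S m) (cnj (p m) / S m)"
  using assms(1)
proof (induction m)
  case 0
  then show ?case
    using path_sum_one[of c l \<sigma>]
    by (simp add: matB_def one_mat22 mat22_mult p_def q_def S_def cis_cnj)
next
  case (Suc m)
  have s: "sin (pi\<^sup>2 / (2 * \<alpha> (Suc m))) \<noteq> 0" using Suc.prems by auto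
  have S: "S (Suc m) = S m * of_real (sin (pi\<^sup>2 / (2 * \<alpha> (Suc m))))" by (simp add: S_def)
  have Sm: "S m \<noteq> 0" using Suc.prems by (auto simp: S_def)
  have IH: "matB (l (Suc m)) \<sigma> * segP \<alpha> l \<sigma> 0 m =
    mat22 (p m / S m) (- \<i> * cnj (q m) / S m) (\<i> * q m / S m) (cnj (p m) / S m)"
    using Suc by auto
  have A: "matA (\<alpha> (Suc m)) = mat22 (1 / of_real (sin (pi\<^sup>2 / (2 * \<alpha> (Suc m)))))
      (- \<i> * of_real (c (Suc m)) / of_real (sin (pi\<^sup>2 / (2 * \<alpha> (Suc m)))))
      (\<i> * of_real (c (Suc m)) / of_real (sin (pi\<^sup>2 / (2 * \<alpha> (Suc m)))))
      (1 / of_real (sin (pi\<^sup>2 / (2 * \<alpha> (Suc m)))))"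
    by (simp add: matA_def Let_def c_def cot_def)
  have p: "p (Suc m) = cis (l (Suc (Suc m)) * \<sigma>) * (p m + of_real (c (Suc m)) * q m)"
    and q: "q (Suc m) = cis (- (l (Suc (Suc m)) * \<sigma>)) * (q m + of_real (c (Suc m)) * p m)"
    using path_sum_Suc[of "Suc m" 1] path_sum_Suc[of "Suc m" "-1"] by (simp_all add: p_def q_def)
  have "segP \<alpha> l \<sigma> 0 (Suc m) = matA (\<alpha> (Suc m)) * (matB (l (Suc m)) \<sigma> * segP \<alpha> l \<sigma> 0 m)"
    by (simp add: assoc_mult_mat[of _ 2 2 _ 2 _ 2])
  then show ?case
    unfolding IH using s Sm
    by (simp add: A matB_def mat22_mult mat22_eq_iff p q S cis_cnj field_simps)
qed

text \<open>Multiplying \<open>matB_segP\<close> by the A of vertex \<open>n\<close> closes the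
  paths in the upper left entry. The norm identity says that the determinant is 1.\<close>

lemma matT_mat22:
  fixes \<alpha> l :: "nat \<Rightarrow> real"
  assumes "1 \<le> n" and s: "\<And>j. j \<in> {1..n} \<Longrightarrow> sin (pi\<^sup>2 / (2 * \<alpha> j)) \<noteq> 0"
  defines "P \<equiv> \<Prod>j=1..n. sin (pi\<^sup>2 / (2 * \<alpha> j))"
    and "h \<equiv> \<lambda>\<sigma>. Complex (F_even n \<alpha> l \<sigma>) (F_odd n \<alpha> l \<sigma>)"
  shows "\<exists>b. matT n \<alpha> l \<sigma> = mat22 (h \<sigma> / of_real P) b (cnj b) (cnj (h \<sigma> / of_real P)) \<and>
    (cmod (h \<sigma>))\<^sup>2 = (1 + (cmod b)\<^sup>2) * P\<^sup>2"
proof -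
  obtain m where n: "n = Suc m" using assms(1) by (cases n) auto
  define c where "c = (\<lambda>j. cos (pi\<^sup>2 / (2 * \<alpha> j)))"
  define D where "D = (\<lambda>n. \<Prod>j=1..n. sin (pi\<^sup>2 / (2 * \<alpha> j)))"
  define p where "p = path_sum c l \<sigma> n 1"
  define q where "q = path_sum c l \<sigma> n (-1)"
  define sn where "sn = sin (pi\<^sup>2 / (2 * \<alpha> n))"
  \<comment> \<open>The upper right entry of the product of \<open>A\<close> and \<open>U\<close>
    below.\<close>
  define b where "b = - \<i> * cnj (q + of_real (c n) * p) / of_real (D n)"
  have Dn: "D n = D m * sn" by (simp add: D_def n sn_def)
  have D0: "D n \<noteq> 0" using s by (simp add: D_def)
  then have nz: "D m \<noteq> 0" "sn \<noteq> 0" using Dn by auto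
  have H: "Complex (F_even n \<alpha> l \<sigma>) (F_odd n \<alpha> l \<sigma>) = p + of_real (c n) * q"
    using F_even_F_odd_path_sum[OF assms(1)] by (simp add: p_def q_def c_def)
  have A: "matA (\<alpha> n) = mat22 (1 / of_real sn) (- \<i> * of_real (c n) / of_real sn)
      (\<i> * of_real (c n) / of_real sn) (1 / of_real sn)"
    by (simp add: matA_def Let_def c_def cot_def sn_def)
  have U: "matB (l (Suc m)) \<sigma> * segP \<alpha> l \<sigma> 0 m = mat22 (p / of_real (D m))
      (- \<i> * cnj q / of_real (D m)) (\<i> * q / of_real (D m)) (cnj p / of_real (D m))"
    using matB_segP[of m \<alpha> l \<sigma>] s by (simp add: n p_def q_def c_def D_def)
  have "matT n \<alpha> l \<sigma> = matA (\<alpha> n) * (matB (l (Suc m)) \<sigma> * segP \<alpha> l \<sigma> 0 m)"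
    by (simp add: matT_def n assoc_mult_mat[of _ 2 2 _ 2 _ 2])
  then have "matT n \<alpha> l \<sigma> = mat22 ((p + of_real (c n) * q) / of_real (D n)) b (cnj b)
      (cnj ((p + of_real (c n) * q) / of_real (D n)))"
    unfolding U A mat22_mult mat22_eq_iff b_def Dn using nz by (simp add: field_simps)
  moreover have "(cmod (p + of_real (c n) * q))\<^sup>2 = (1 + (cmod b)\<^sup>2) * (D n)\<^sup>2"
  \<comment> \<open>Apply \<open>path_sum_norm\<close> up to vertex \<open>m\<close>, then one more
    hyperbolic rotation with \<open>t = c n\<close>.\<close>
  proof -
    have "(cmod p)\<^sup>2 - (cmod q)\<^sup>2 = (D m)\<^sup>2"
      unfolding p_def q_def n D_def by (rule path_sum_norm) (simp add: c_def)
    moreover have "sn\<^sup>2 = 1 - (c n)\<^sup>2"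
      unfolding sn_def c_def by (rule sin_squared_eq)
    ultimately have "(D n)\<^sup>2 = (1 - (c n)\<^sup>2) * ((cmod p)\<^sup>2 - (cmod q)\<^sup>2)"
      by (simp add: Dn power_mult_distrib)
    also have "\<dots> = (cmod (p + of_real (c n) * q))\<^sup>2 - (cmod (q + of_real (c n) * p))\<^sup>2"
      by (rule hyperbolic_rotation_cmod[symmetric])
    also have "(cmod (q + of_real (c n) * p))\<^sup>2 = (cmod b)\<^sup>2 * (D n)\<^sup>2"
      using D0 by (simp add: b_def norm_mult norm_divide power_mult_distrib power_divide
          flip: complex_cnj_mult complex_cnj_add)
    finally show ?thesis by (simp add: algebra_simps)
  qed
  ultimately show ?thesis unfolding h_def P_def H D_def by blast
qed

section \<open>Trigonometry of exceptional and non-exceptional angles\<close>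

text \<open>A zero of the sine puts the argument at an integer multiple of \<open>pi\<close>;
  positivity of \<open>a\<close> makes that integer a natural number at least 1, so \<open>a\<close>
  is exceptional.\<close>

lemma sin_nonexceptional:
  assumes "0 < a" "a \<notin> exc_angles"
  shows "sin (pi\<^sup>2 / (2 * a)) \<noteq> 0"
proof
  assume "sin (pi\<^sup>2 / (2 * a)) = 0"
  then obtain i :: int where i: "pi\<^sup>2 / (2 * a) = of_int i * pi"
    unfolding sin_zero_iff_int2 by auto
  have "0 < of_int i * pi" unfolding i[symmetric] using assms by simp
  then have pos: "0 < i" by (simp add: zero_less_mult_iff)
  have "pi * pi = of_int i * pi * (2 * a)"
    using i assms by (simp add: power2_eq_square field_simps)
  then have "a = pi / (2 * real (nat i))" "1 \<le> nat i"
    using pos by (simp_all add: field_simps)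
  then show False using assms(2) unfolding exc_angles_def by blast
qed

lemma cos_exceptional:
  assumes "a \<in> exc_angles"
  shows "cos (pi\<^sup>2 / (2 * a)) = of_int (parity_O a)" "parity_O a = 1 \<or> parity_O a = -1"
proof -
  obtain k :: nat where k: "1 \<le> k" "a = pi / (2 * real k)"
    using assms by (auto simp: exc_angles_def)
  \<comment> \<open>The description in \<open>parity_O\<close> is well defined because
    \<open>pi / (2 * real k)\<close> determines \<open>k\<close>.\<close>
  have "(THE k'::nat. k' \<ge> 1 \<and> a = pi / (2 * real k')) = k"
    by (rule the_equality) (use k in \<open>auto simp: field_simps\<close>)
  then have par: "parity_O a = (-1) ^ k" by (simp add: parity_O_def)
  have "pi\<^sup>2 / (2 * a) = real k * pi" using k(1) by (simp add: k(2) power2_eq_square)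
  then show "cos (pi\<^sup>2 / (2 * a)) = of_int (parity_O a)" by (simp add: par cos_npi)
  show "parity_O a = 1 \<or> parity_O a = -1" unfolding par by (cases "even k") auto
qed

section \<open>Non-exceptional polygons\<close>

lemma mult_nonexc_root:
  fixes \<alpha> l :: "nat \<Rightarrow> real"
  assumes adm: "admissible n \<alpha> l" and ne: "non_exceptional n \<alpha>"
    and "0 < \<sigma>" and root: "F_P n \<alpha> l \<sigma> = 0"
  shows "qe_nonexc n \<alpha> l \<sigma>"
    "mult_nonexc n \<alpha> l \<sigma> = (if F_odd n \<alpha> l \<sigma> = 0 then 2 else 1)"
proof -
  define D where "D = (\<Prod>j=1..n. sin (pi\<^sup>2 / (2 * \<alpha> j)))"
  \<comment> \<open>At a root this is the imaginary part of the upper left entry of T, whose real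
    part is 1.\<close>
  define y where "y = F_odd n \<alpha> l \<sigma> / D"
  have s: "sin (pi\<^sup>2 / (2 * \<alpha> j)) \<noteq> 0" if "j \<in> {1..n}" for j
    using that adm ne sin_nonexceptional by (auto simp: admissible_def non_exceptional_def)
  have n: "1 \<le> n" using adm by (simp add: admissible_def)
  have D: "D \<noteq> 0" using s by (simp add: D_def)
  have F: "F_even n \<alpha> l \<sigma> = D" "F_odd n \<alpha> l \<sigma> = y * D"
    using root D by (simp_all add: F_P_def D_def y_def)
  obtain b where T: "matT n \<alpha> l \<sigma> =
      mat22 (Complex D (y * D) / of_real D) b (cnj b) (cnj (Complex D (y * D) / of_real D))"
    and "(cmod (Complex D (y * D)))\<^sup>2 = (1 + (cmod b)\<^sup>2) * D\<^sup>2"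
    using matT_mat22[of n \<alpha> l \<sigma>, OF n s] unfolding F D_def[symmetric] by blast
  then have b: "D\<^sup>2 + (y * D)\<^sup>2 = (1 + (cmod b)\<^sup>2) * D\<^sup>2"
    by (simp add: cmod_power2)
  have a: "Complex D (y * D) / of_real D = 1 + \<i> * of_real y"
    using D by (simp add: complex_eq_iff)
  have "(1 + y\<^sup>2) * D\<^sup>2 = (1 + (cmod b)\<^sup>2) * D\<^sup>2"
    using b by (simp add: algebra_simps power_mult_distrib)
  then have norm_b: "y\<^sup>2 = (cmod b)\<^sup>2" using D by simp
  have bb: "b * cnj b = of_real (y\<^sup>2)" unfolding norm_b by (rule complex_norm_square[symmetric])
  \<comment> \<open>The diagonal entries minus 1 are \<open>\<i> * y\<close> and its conjugate, with
    product \<open>y\<^sup>2\<close>, which equals the product of the off-diagonal entries.\<close>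
  have ev: "eigenvalue (matT n \<alpha> l \<sigma>) 1"
    unfolding T a eigenvalue_mat22 bb by (simp add: complex_eq_iff power2_eq_square)
  then show "qe_nonexc n \<alpha> l \<sigma>" using \<open>0 < \<sigma>\<close> by (simp add: qe_nonexc_def)
  show "mult_nonexc n \<alpha> l \<sigma> = (if F_odd n \<alpha> l \<sigma> = 0 then 2 else 1)"
    unfolding mult_nonexc_def T a dim_eigenspace_mat22[OF ev[unfolded T a]] F
    using D norm_b by (auto simp: complex_eq_iff)
qed

section \<open>Exceptional polygons: boundary vectors and components\<close>

lemma mat22_mult_vec:
  "mat22 a b c d *\<^sub>v vec_of_list [x, y] = vec_of_list [a * x + b * y, c * x + d * y]"
  for a b c d x y :: "'a :: comm_ring_1"
  by (rule eq_vecI)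
    (auto simp: mat_of_rows_list_def scalar_prod_def numeral_2_eq_2 less_Suc_eq vec_of_list_index)

lemma hdot_vec_of_list: "hdot (vec_of_list [x, y]) (vec_of_list [z, w]) = x * cnj z + y * cnj w"
  by (simp add: hdot_def vec_of_list_index del: vec_of_list_Cons)

lemma Xvec_cartesian:
  "Xvec a = (if parity_O a = 1 then vec_of_list [Complex (1/2) (-1/2), Complex (1/2) (1/2)]
     else vec_of_list [Complex (1/2) (1/2), Complex (1/2) (-1/2)])"
proof -
  have "cis (pi / 4) / complex_of_real (sqrt 2) = Complex (1/2) (1/2)"
    "cis (- pi / 4) / complex_of_real (sqrt 2) = Complex (1/2) (-1/2)"
    by (simp_all add: complex_eq_iff cos_45 sin_45 field_simps)
  then show ?thesis by (simp add: Xvec_def X_even_def X_odd_def)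
qed

text \<open>Both X vectors have the form \<open>(w, cnj w)\<close>, which matrices of this shape
  preserve, so the product is twice the real part of \<open>u * cnj v\<close> for the first entries.
  Relative phases 1 and \<open>\<plusminus>\<i>\<close> of the X vectors select real parts for equal
  and imaginary parts for opposite parities.\<close>

lemma hdot_Xvec:
  assumes "parity_O a = 1 \<or> parity_O a = -1" "parity_O a' = 1 \<or> parity_O a' = -1"
  shows "hdot (mat22 p (- \<i> * cnj q) (\<i> * q) (cnj p) *\<^sub>v Xvec a) (Xvec a') =
    (if parity_O a = parity_O a' then of_real (Re p + of_int (parity_O a') * Re q)
     else of_real (of_int (parity_O a) * (Im p + of_int (parity_O a') * Im q)))"
  using assms unfolding Xvec_cartesian
  by (auto simp: mat22_mult_vec hdot_vec_of_list complex_eq_iff algebra_simps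
      simp del: vec_of_list_Cons)

text \<open>Consecutive entries of the sorted list enclose no element of \<open>S\<close>. For
  \<open>k = 1\<close> the value 0 acts as a virtual predecessor, as in
  \<open>comp_start\<close>.\<close>

lemma sorted_list_of_set_nth_gap:
  fixes S :: "nat set"
  assumes S: "finite S" "0 \<notin> S" and k: "1 \<le> k" "k \<le> card S"
  defines "a \<equiv> (if k = 1 then 0 else sorted_list_of_set S ! (k - 2))"
    and "b \<equiv> sorted_list_of_set S ! (k - 1)"
  shows "b \<in> S" "a < b" "\<And>i. a < i \<Longrightarrow> i < b \<Longrightarrow> i \<notin> S"
proof -
  define xs where "xs = sorted_list_of_set S"
  have xs: "length xs = card S" "set xs = S" "sorted_wrt (<) xs"
    using S by (simp_all add: xs_def)
  have mono: "xs ! i < xs ! j \<longleftrightarrow> i < j" if "i < card S" "j < card S" for i j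
    using that xs by (metis linorder_neqE_nat not_less_iff_gr_or_eq sorted_wrt_nth_less)
  show b: "b \<in> S"
    using nth_mem[of "k - 1" xs] k xs(1,2) by (simp add: b_def xs_def[symmetric])
  show "a < b"
    using b S k mono[of "k - 2" "k - 1"]
    by (auto simp: a_def b_def xs_def[symmetric] intro: gr0I)
  fix i assume i: "a < i" "i < b"
  show "i \<notin> S"
  proof
    assume "i \<in> S"
    then obtain m where m: "m < card S" "i = xs ! m"
      using xs by (metis in_set_conv_nth)
    \<comment> \<open>For \<open>k = 1\<close> this is already impossible; otherwise
      \<open>m\<close> would have to lie strictly between \<open>k - 2\<close> and
      \<open>k - 1\<close>.\<close>
    have "m < k - 1"
      using i(2) mono[of m "k - 1"] m k by (auto simp: b_def xs_def[symmetric])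
    moreover from this have "xs ! (k - 2) < xs ! m"
      using i(1) m(2) by (auto simp: a_def xs_def[symmetric] split: if_splits)
    then have "k - 2 < m" using mono[of "k - 2" m] m k by auto
    ultimately show False by linarith
  qed
qed

text \<open>Only the final vertex of a component is exceptional, so the sines at its inner vertices
  do not vanish and \<open>matB_segP\<close> applies.\<close>

lemma exc_component:
  assumes "\<kappa> \<in> {1..numK n \<alpha>}"
  shows "\<alpha> (E n \<alpha> \<kappa>) \<in> exc_angles" "comp_start n \<alpha> \<kappa> < E n \<alpha> \<kappa>" "E n \<alpha> \<kappa> \<le> n"
    "\<And>i. comp_start n \<alpha> \<kappa> < i \<Longrightarrow> i < E n \<alpha> \<kappa> \<Longrightarrow> \<alpha> i \<notin> exc_angles"
proof -
  let ?S = "exc_idx n \<alpha>"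
  have S: "finite ?S" "0 \<notin> ?S" by (auto simp: exc_idx_def)
  have k: "1 \<le> \<kappa>" "\<kappa> \<le> card ?S" using assms by (auto simp: numK_def)
  have En: "sorted_list_of_set ?S ! (\<kappa> - 1) = E n \<alpha> \<kappa>"
    "(if \<kappa> = 1 then 0 else sorted_list_of_set ?S ! (\<kappa> - 2)) = comp_start n \<alpha> \<kappa>"
    using k by (auto simp: E_def comp_start_def numeral_2_eq_2)
  note gap = sorted_list_of_set_nth_gap[OF S k, unfolded En]
  show "\<alpha> (E n \<alpha> \<kappa>) \<in> exc_angles" "E n \<alpha> \<kappa> \<le> n" using gap(1) by (auto simp: exc_idx_def)
  then show "comp_start n \<alpha> \<kappa> < E n \<alpha> \<kappa>" using gap(2) by simp
  show "\<alpha> i \<notin> exc_angles" if "comp_start n \<alpha> \<kappa> < i" "i < E n \<alpha> \<kappa>" for i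
    using gap(3)[OF that] that \<open>E n \<alpha> \<kappa> \<le> n\<close> by (auto simp: exc_idx_def)
qed

lemma exc_angle_predecessor:
  assumes "\<kappa> \<in> {1..numK n \<alpha>}"
  shows "\<alpha> (E n \<alpha> (\<kappa> - 1)) \<in> exc_angles"
proof (cases "\<kappa> = 1")
  case True
  \<comment> \<open>The convention for index 0 closes the cycle: the first component is preceded by
    the last exceptional vertex.\<close>
  have "E n \<alpha> 0 = E n \<alpha> (numK n \<alpha>)" using assms by (simp add: E_def)
  then show ?thesis using exc_component(1)[of "numK n \<alpha>" n \<alpha>] assms True by simp
next
  case False
  then have "\<kappa> - 1 \<in> {1..numK n \<alpha>}" using assms by auto
  then show ?thesis by (rule exc_component(1))
qed

text \<open>The exceptional angle enters \<open>F_even\<close> and \<open>F_odd\<close> only through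
  its cosine, which is its parity. The inner product is therefore the relevant polynomial divided by
  the nonzero sine product, up to sign.\<close>

lemma exc_cond_iff_comp_root:
  assumes adm: "admissible n \<alpha> l" and \<kappa>: "\<kappa> \<in> {1..numK n \<alpha>}"
  shows "exc_cond n \<alpha> l \<kappa> \<sigma> \<longleftrightarrow> comp_root n \<alpha> l \<kappa> \<sigma>"
proof -
  note comp = exc_component[OF \<kappa>]
  define k where "k = comp_start n \<alpha> \<kappa>"
  define m where "m = comp_len n \<alpha> \<kappa> - 1"
  define a where "a = comp_alpha n \<alpha> \<kappa>"
  define r where "r = comp_ell n \<alpha> l \<kappa>"
  define e where "e = parity_O (\<alpha> (E n \<alpha> (\<kappa> - 1)))"
  define e' where "e' = parity_O (\<alpha> (E n \<alpha> \<kappa>))"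
  have len: "comp_len n \<alpha> \<kappa> = Suc m" and last: "k + Suc m = E n \<alpha> \<kappa>"
    using comp(2) by (simp_all add: m_def k_def comp_len_def)
  \<comment> \<open>Only the inner vertices \<open>1..m\<close> are covered; vertex
    \<open>Suc m\<close> of the component is the exceptional one.\<close>
  have s: "sin (pi\<^sup>2 / (2 * a j)) \<noteq> 0" if "j \<in> {1..m}" for j
    using that comp(3) comp(4)[of "k + j"] adm last
    by (intro sin_nonexceptional) (auto simp: a_def comp_alpha_def k_def admissible_def)
  define c where "c = (\<lambda>j. cos (pi\<^sup>2 / (2 * a j)))"
  define S where "S = (\<Prod>j=1..m. sin (pi\<^sup>2 / (2 * a j)))"
  define p where "p = path_sum c r \<sigma> (Suc m) 1"
  define q where "q = path_sum c r \<sigma> (Suc m) (-1)"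
  have "S \<noteq> 0" using s by (simp add: S_def)
  have ar: "(\<lambda>i. \<alpha> (k + i)) = a" "(\<lambda>i. l (k + i)) = r"
    by (auto simp: a_def r_def comp_alpha_def comp_ell_def k_def)
  then have "l (E n \<alpha> \<kappa>) = r (Suc m)" using last by metis
  then have "matU n \<alpha> l \<kappa> \<sigma> = matB (r (Suc m)) \<sigma> * segP a r \<sigma> 0 m"
    using segP_shift[of \<alpha> l \<sigma> k m] by (simp add: matU_def m_def k_def[symmetric] ar)
  also have "\<dots> = mat22 (p / of_real S) (- \<i> * cnj (q / of_real S)) (\<i> * (q / of_real S)) (cnj (p / of_real S))"
    using matB_segP[where \<alpha> = a and l = r and \<sigma> = \<sigma>, OF s] by (simp add: p_def q_def c_def S_def)
  finally have U: "matU n \<alpha> l \<kappa> \<sigma> = \<dots>" .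
  have e: "e = 1 \<or> e = -1" and e': "e' = 1 \<or> e' = -1"
    using cos_exceptional(2) exc_angle_predecessor[OF \<kappa>] comp(1) by (auto simp: e_def e'_def)
  have c: "c (Suc m) = of_int e'"
    using cos_exceptional(1)[OF comp(1)] last
    by (simp add: c_def e'_def a_def comp_alpha_def k_def)
  have "Complex (F_even (Suc m) a r \<sigma>) (F_odd (Suc m) a r \<sigma>) = p + of_real (of_int e') * q"
    using F_even_F_odd_path_sum[of "Suc m" a r \<sigma>] c by (simp add: p_def q_def c_def)
  then have F: "F_even (Suc m) a r \<sigma> = Re p + of_int e' * Re q"
    "F_odd (Suc m) a r \<sigma> = Im p + of_int e' * Im q"
    by (simp_all add: complex_eq_iff)
  have "Re p / S + of_int e' * (Re q / S) = F_even (Suc m) a r \<sigma> / S"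
    "Im p / S + of_int e' * (Im q / S) = F_odd (Suc m) a r \<sigma> / S"
    by (simp_all add: F add_divide_distrib)
  then have "hdot (matU n \<alpha> l \<kappa> \<sigma> *\<^sub>v Xvec (\<alpha> (E n \<alpha> (\<kappa> - 1)))) (Xvec (\<alpha> (E n \<alpha> \<kappa>))) =
    (if e = e' then of_real (F_even (Suc m) a r \<sigma> / S)
     else of_real (of_int e * (F_odd (Suc m) a r \<sigma> / S)))"
    unfolding U using hdot_Xvec[OF e[unfolded e_def] e'[unfolded e'_def], of "p / of_real S" "q / of_real S"]
    by (simp add: e_def e'_def)
  then show ?thesis
    using \<open>S \<noteq> 0\<close> e
    unfolding exc_cond_def comp_root_def len e_def[symmetric] e'_def[symmetric] a_def[symmetric] r_def[symmetric]
    by auto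
qed

theorem theorem2p12:
  fixes n :: nat and \<alpha> l :: "nat \<Rightarrow> real"
  assumes adm: "admissible n \<alpha> l"
  shows
    "(non_exceptional n \<alpha> \<longrightarrow>
       (\<forall>\<sigma>::real. \<sigma> > 0 \<and> F_P n \<alpha> l \<sigma> = 0 \<longrightarrow>
          qe_nonexc n \<alpha> l \<sigma> \<and>
          mult_nonexc n \<alpha> l \<sigma> = (if F_odd n \<alpha> l \<sigma> = 0 then 2 else 1)))
   \<and>
     (\<alpha> n \<in> exc_angles \<longrightarrow>
       (\<forall>\<sigma>::real. \<sigma> \<ge> 0 \<longrightarrow>
          (qe_exc n \<alpha> l \<sigma> \<longleftrightarrow> (\<exists>\<kappa>\<in>{1..numK n \<alpha>}. comp_root n \<alpha> l \<kappa> \<sigma>))) \<and>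
       (\<forall>\<sigma>::real. \<sigma> > 0 \<and> qe_exc n \<alpha> l \<sigma> \<longrightarrow>
          mult_exc n \<alpha> l \<sigma> = real (card {\<kappa>\<in>{1..numK n \<alpha>}. comp_root n \<alpha> l \<kappa> \<sigma>})) \<and>
       (mult_exc n \<alpha> l 0 = real (card {\<kappa>\<in>{1..numK n \<alpha>}.
              parity_O (\<alpha> (E n \<alpha> (\<kappa> - 1))) = - parity_O (\<alpha> (E n \<alpha> \<kappa>))}) / 2))"
proof -
  have cond: "exc_cond n \<alpha> l \<kappa> \<sigma> \<longleftrightarrow> comp_root n \<alpha> l \<kappa> \<sigma>" if "\<kappa> \<in> {1..numK n \<alpha>}" for \<kappa> \<sigma>
    using exc_cond_iff_comp_root[OF adm that] .
  \<comment> \<open>Parities of exceptional angles are 1 or -1, so being different means being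
    opposite.\<close>
  have par: "parity_O (\<alpha> (E n \<alpha> (\<kappa> - 1))) \<noteq> parity_O (\<alpha> (E n \<alpha> \<kappa>)) \<longleftrightarrow>
      parity_O (\<alpha> (E n \<alpha> (\<kappa> - 1))) = - parity_O (\<alpha> (E n \<alpha> \<kappa>))" if "\<kappa> \<in> {1..numK n \<alpha>}" for \<kappa>
    using cos_exceptional(2)[OF exc_component(1)[OF that]]
      cos_exceptional(2)[OF exc_angle_predecessor[OF that]] by auto
  have roots: "{\<kappa> \<in> {1..numK n \<alpha>}. exc_cond n \<alpha> l \<kappa> \<sigma>} =
      {\<kappa> \<in> {1..numK n \<alpha>}. comp_root n \<alpha> l \<kappa> \<sigma>}" for \<sigma>
    using cond by blast
  have parities: "{\<kappa> \<in> {1..numK n \<alpha>}. parity_O (\<alpha> (E n \<alpha> (\<kappa> - 1))) \<noteq> parity_O (\<alpha> (E n \<alpha> \<kappa>))} =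
      {\<kappa> \<in> {1..numK n \<alpha>}. parity_O (\<alpha> (E n \<alpha> (\<kappa> - 1))) = - parity_O (\<alpha> (E n \<alpha> \<kappa>))}"
    using par by blast
  have "qe_exc n \<alpha> l \<sigma> \<longleftrightarrow> (\<exists>\<kappa>\<in>{1..numK n \<alpha>}. comp_root n \<alpha> l \<kappa> \<sigma>)" if "\<sigma> \<ge> 0" for \<sigma>
    unfolding qe_exc_def using that cond by blast
  moreover have "mult_exc n \<alpha> l \<sigma> = real (card {\<kappa>\<in>{1..numK n \<alpha>}. comp_root n \<alpha> l \<kappa> \<sigma>})"
    if "\<sigma> > 0" for \<sigma>
    unfolding mult_exc_def roots using that by (rule if_P)
  moreover have "mult_exc n \<alpha> l 0 = real (card {\<kappa>\<in>{1..numK n \<alpha>}.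
      parity_O (\<alpha> (E n \<alpha> (\<kappa> - 1))) = - parity_O (\<alpha> (E n \<alpha> \<kappa>))}) / 2"
    unfolding mult_exc_def parities by (rule if_not_P) (rule less_irrefl)
  ultimately show ?thesis
    using mult_nonexc_root[OF adm] by blast
qed

end
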